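(* Let $\mathcal{A}>0$, $\mathcal{C}>0$ and $\gamma\in\left[0,\frac{\pi}{2}\right)$, and let $\hat F_T:[0,\pi]\to\mathbb{R}$ be the dimensionless total force defined in the context. If $\frac{d\hat F_T}{d\phi_0}(\pi)\ge 0$, then $\hat F_T$ admits at most one equilibrium point, and it is stable if it exists. If $\frac{d\hat F_T}{d\phi_0}(\pi)<0$, then $\hat F_T$ admits at most two equilibrium points; if there are two, the smaller one is stable and the larger one is unstable. In addition, in the case $\frac{d\hat F_T}{d\phi_0}(\pi)<0$, if $\hat F_T$ admits only one equilibrium point $\bar\phi_0$, then $\bar\phi_0$ is stable if $\frac{d\hat F_T}{d\phi_0}(\bar\phi_0)>0$, and it is unstable if $\frac{d\hat F_T}{d\phi_0}(\bar\phi_0)=0$.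
   Context: For parameters $\mathcal{A}>0$, $\mathcal{C}>0$ and contact angle $\gamma\in[0,\pi]$, the dimensionless total force on the floating cylinder, as a function of the wetting angle $\phi_0\in[0,\pi]$, is $$\hat F_T(\phi_0)=-\mathcal{A}\mathcal{C}^2-2\sin(\phi_0+\gamma)-4\mathcal{C}\cos\left(\frac{\phi_0+\gamma}{2}\right)\sin\phi_0-\frac12\mathcal{C}^2\sin 2\phi_0+\mathcal{C}^2\phi_0.$$ The total energy, divided by the positive constant $\sigma a$ (surface tension times radius), is $$\begin{aligned}\hat E_T(\phi_0)={}&\mathcal{A}\mathcal{C}^2\left[\cos\phi_0+\tfrac{2}{\mathcal{C}}\cos\left(\tfrac{\phi_0+\gamma}{2}\right)\right]-2\phi_0\cos\gamma+\tfrac{8}{3\mathcal{C}}\left[1-\sin^3\left(\tfrac{\phi_0+\gamma}{2}\right)\right]+2\sin\phi_0\cos(\phi_0+\gamma)\\&+\mathcal{C}^2\left[\tfrac1{12}\sin3\phi_0-\phi_0\cos\phi_0+\tfrac34\sin\phi_0\right]+\mathcal{C}\cos\left(\tfrac{\phi_0+\gamma}{2}\right)\left[\sin2\phi_0-2\phi_0\right].\end{aligned}$$ An equilibrium point is a $\bar\phi_0\in[0,\pi]$ with $\hat F_T(\bar\phi_0)=0$. An equilibrium point is called stable if it is a strict local minimum of $\hat E_T$ on $[0,\pi]$, and unstable if it is not a local minimum of $\hat E_T$ on $[0,\pi]$. *)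

theory Defs
  imports "HOL-Analysis.Analysis"
begin

text \<open>Force and energy are given by formulas that are smooth on the whole real line; the
  wetting angle is restricted to \<open>{0..pi}\<close> in the definitions of equilibria and of local minima.
  The derivative of the force at \<open>0\<close> or \<open>pi\<close> (the paper's one-sided derivative)
  therefore agrees with the two-sided \<open>deriv\<close> of the formula.\<close>

definition total_force :: "real \<Rightarrow> real \<Rightarrow> real \<Rightarrow> real \<Rightarrow> real" where
  "total_force A C \<gamma> \<phi> =
     - A * C^2 - 2 * sin (\<phi> + \<gamma>) - 4 * C * cos ((\<phi> + \<gamma>) / 2) * sin \<phi>
     - 1/2 * C^2 * sin (2 * \<phi>) + C^2 * \<phi>"

definition total_energy :: "real \<Rightarrow> real \<Rightarrow> real \<Rightarrow> real \<Rightarrow> real" where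
  "total_energy A C \<gamma> \<phi> =
     A * C^2 * (cos \<phi> + 2 / C * cos ((\<phi> + \<gamma>) / 2))
     - 2 * \<phi> * cos \<gamma>
     + 8 / (3 * C) * (1 - sin ((\<phi> + \<gamma>) / 2) ^ 3)
     + 2 * sin \<phi> * cos (\<phi> + \<gamma>)
     + C^2 * (1/12 * sin (3 * \<phi>) - \<phi> * cos \<phi> + 3/4 * sin \<phi>)
     + C * cos ((\<phi> + \<gamma>) / 2) * (sin (2 * \<phi>) - 2 * \<phi>)"

definition local_min_on :: "real set \<Rightarrow> (real \<Rightarrow> real) \<Rightarrow> real \<Rightarrow> bool" where
  "local_min_on S f x \<longleftrightarrow> x \<in> S \<and> (\<forall>\<^sub>F y in at x within S. f x \<le> f y)"

definition strict_local_min_on :: "real set \<Rightarrow> (real \<Rightarrow> real) \<Rightarrow> real \<Rightarrow> bool" where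
  "strict_local_min_on S f x \<longleftrightarrow> x \<in> S \<and> (\<forall>\<^sub>F y in at x within S. f x < f y)"

definition equilibrium :: "real \<Rightarrow> real \<Rightarrow> real \<Rightarrow> real \<Rightarrow> bool" where
  "equilibrium A C \<gamma> \<phi> \<longleftrightarrow> \<phi> \<in> {0..pi} \<and> total_force A C \<gamma> \<phi> = 0"

definition stable_equilibrium :: "real \<Rightarrow> real \<Rightarrow> real \<Rightarrow> real \<Rightarrow> bool" where
  "stable_equilibrium A C \<gamma> \<phi> \<longleftrightarrow>
     equilibrium A C \<gamma> \<phi> \<and> strict_local_min_on {0..pi} (total_energy A C \<gamma>) \<phi>"

definition unstable_equilibrium :: "real \<Rightarrow> real \<Rightarrow> real \<Rightarrow> real \<Rightarrow> bool" where
  "unstable_equilibrium A C \<gamma> \<phi> \<longleftrightarrow>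
     equilibrium A C \<gamma> \<phi> \<and> \<not> local_min_on {0..pi} (total_energy A C \<gamma>) \<phi>"

end

(* The energy is a primitive of the force up to a factor that is positive on (0, pi], namely
   E' = (sin phi + sin ((phi + gamma) / 2) / C) * F, so that stability is read off the sign of F.
   Half the derivative of the force increases on [0, pi/2] from a negative to a positive value, is
   positive on [pi/2, pi - gamma] and decreases on [pi - gamma, pi].  Since F(0) < 0, the force is
   negative while it first decreases; then it increases, and it decreases again at the end exactly
   when F'(pi) < 0.  An equilibrium on the increasing branch is stable, one on the last
   decreasing branch is unstable. *)

theory Submission
  imports Defs
begin

section \<open>Derivatives of the force and the energy\<close>

definition half_force_deriv :: "real \<Rightarrow> real \<Rightarrow> real \<Rightarrow> real" where
  "half_force_deriv C \<gamma> x =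
     - cos (x + \<gamma>) + C * (sin ((x + \<gamma>) / 2) * sin x - 2 * cos ((x + \<gamma>) / 2) * cos x)
     + C\<^sup>2 * (sin x)\<^sup>2"

lemma total_force_has_derivative:
  "(total_force A C \<gamma> has_real_derivative 2 * half_force_deriv C \<gamma> x) (at x)"
proof -
  \<comment> \<open>This merges the terms - C^2 cos 2x + C^2 of the derivative into 2 C^2 sin^2 x,
    which is visibly nonnegative.\<close>
  have c: "cos (x * 2) = 1 - 2 * (sin x)\<^sup>2"
    using cos_double_sin[of x] by (simp add: mult.commute)
  show ?thesis
    unfolding total_force_def half_force_deriv_def
    by (rule derivative_eq_intros refl | simp)+ (simp add: c algebra_simps)
qed

lemma deriv_total_force: "deriv (total_force A C \<gamma>) x = 2 * half_force_deriv C \<gamma> x"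
  by (rule DERIV_imp_deriv[OF total_force_has_derivative])

text \<open>The factor before the force is minus the derivative of the bracket that A C^2 multiplies
  in the energy, so the terms with A match at once. The others match by trigonometric
  identities.\<close>

lemma total_energy_has_derivative:
  assumes "C > 0"
  shows "(total_energy A C \<gamma> has_real_derivative
           (sin x + sin ((x + \<gamma>) / 2) / C) * total_force A C \<gamma> x) (at x)"
proof -
  \<comment> \<open>In terms of a and x, every angle is a multiple of a or x, or their difference.
    The two occurrences of \<open>cos (2 * a)\<close> cancel, so only \<open>sin (2 * a)\<close>
    needs expanding.\<close>
  define a where "a = (x + \<gamma>) / 2"
  have xg: "x + \<gamma> = 2 * a" and g: "\<gamma> = 2 * a - x"
    by (simp_all add: a_def field_simps)
  have c3: "cos (3 * x) = 4 * cos x ^ 3 - 3 * cos x"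
    by (rule cos_treble_cos)
  have cg: "cos \<gamma> = cos (2 * a) * cos x + sin (2 * a) * sin x"
    unfolding g by (rule cos_diff)
  have c2: "cos (2 * x) = 1 - 2 * (sin x)\<^sup>2"
    by (rule cos_double_sin)
  \<comment> \<open>Thus cos 3x / 4 - cos x / 4 becomes - cos x sin^2 x, which is sin x times the
    force term - sin 2x / 2.\<close>
  have cube: "cos x ^ 3 = cos x * (1 - (sin x)\<^sup>2)"
    by (simp add: power3_eq_cube flip: cos_squared_eq power2_eq_square)
  have "(total_energy A C \<gamma> has_real_derivative
      A * C\<^sup>2 * (- sin x - sin ((x + \<gamma>) / 2) / C) - 2 * cos \<gamma>
      - 4 / C * (sin ((x + \<gamma>) / 2))\<^sup>2 * cos ((x + \<gamma>) / 2)
      + 2 * cos x * cos (x + \<gamma>) - 2 * sin x * sin (x + \<gamma>)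
      + C\<^sup>2 * (cos (3 * x) / 4 - cos x / 4 + x * sin x)
      + C * (- sin ((x + \<gamma>) / 2) / 2 * (sin (2 * x) - 2 * x) + cos ((x + \<gamma>) / 2)
          * (2 * cos (2 * x) - 2))) (at x)"
    unfolding total_energy_def using assms
    by (auto intro!: derivative_eq_intros
        simp: field_simps power2_eq_square power3_eq_cube)
  moreover have "A * C\<^sup>2 * (- sin x - sin a / C) - 2 * cos \<gamma> - 4 / C * (sin a)\<^sup>2 * cos a
      + 2 * cos x * cos (2 * a) - 2 * sin x * sin (2 * a)
      + C\<^sup>2 * (cos (3 * x) / 4 - cos x / 4 + x * sin x)
      + C * (- sin a / 2 * (sin (2 * x) - 2 * x) + cos a * (2 * cos (2 * x) - 2))
    = (sin x + sin a / C) * total_force A C \<gamma> x"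
    unfolding total_force_def xg cg c3 c2 cube sin_double a_def[symmetric] using assms
    by (simp add: field_simps power2_eq_square)
  ultimately show ?thesis
    unfolding xg by simp
qed

section \<open>Sign of the derivative of the force\<close>

lemma half_force_deriv_has_derivative:
  "(half_force_deriv C \<gamma> has_real_derivative
     sin (x + \<gamma>) + C * (5/2 * (cos ((x + \<gamma>) / 2) * sin x) + 2 * (sin ((x + \<gamma>) / 2) * cos x))
     + 2 * C\<^sup>2 * (sin x * cos x)) (at x)"
  unfolding half_force_deriv_def
  by (rule derivative_eq_intros refl | simp add: algebra_simps)+

text \<open>For t in (0, pi/2), the bound \<gamma> < pi/2 puts t + \<gamma> in (0, pi) and its half
  in (0, pi/2), so every summand of the derivative is positive.\<close>

lemma half_force_deriv_strict_mono:
  assumes C: "C > 0" and \<gamma>: "\<gamma> \<in> {0..<pi/2}" and xy: "0 \<le> x" "x < y" "y \<le> pi/2"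
  shows "half_force_deriv C \<gamma> x < half_force_deriv C \<gamma> y"
proof (rule DERIV_pos_imp_increasing_open[OF xy(2)])
  fix t assume "x < t" "t < y"
  with xy have t: "0 < t" "t < pi/2" by auto
  have "sin (t + \<gamma>) > 0" "sin t > 0" "cos t > 0" "sin ((t + \<gamma>) / 2) > 0" "cos ((t + \<gamma>) / 2) > 0"
    using t \<gamma> by (auto intro!: sin_gt_zero cos_gt_zero_pi)
  then have "sin (t + \<gamma>) + C * (5/2 * (cos ((t + \<gamma>) / 2) * sin t) + 2 * (sin ((t + \<gamma>) / 2) * cos t))
     + 2 * C\<^sup>2 * (sin t * cos t) > 0"
    using C by (intro add_pos_pos mult_pos_pos) auto
  then show "\<exists>D. (half_force_deriv C \<gamma> has_real_derivative D) (at t) \<and> 0 < D"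
    using half_force_deriv_has_derivative by blast
qed (auto intro!: continuous_intros simp: half_force_deriv_def)

text \<open>Here t and (t + \<gamma>) / 2 lie in (pi/2, pi), and t + \<gamma> lies in (pi, 2 pi), so
  every summand of the derivative is negative.\<close>

lemma half_force_deriv_strict_antimono:
  assumes C: "C > 0" and \<gamma>: "\<gamma> \<in> {0..<pi/2}" and xy: "pi - \<gamma> \<le> x" "x < y" "y \<le> pi"
  shows "half_force_deriv C \<gamma> y < half_force_deriv C \<gamma> x"
proof (rule DERIV_neg_imp_decreasing_open[OF xy(2)])
  fix t assume "x < t" "t < y"
  with xy \<gamma> have t: "pi - \<gamma> < t" "t < pi" "pi/2 < t" by auto
  \<comment> \<open>A shift by pi flips the sign and moves the angle to where the cosine is
    positive.\<close>
  have half: "cos ((t + \<gamma>) / 2 - pi) > 0"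
    using t \<gamma> by (intro cos_gt_zero_pi) (auto simp: field_simps)
  have *: "- sin (t + \<gamma>) > 0" "sin t > 0" "- cos t > 0" "sin ((t + \<gamma>) / 2) > 0"
      "- cos ((t + \<gamma>) / 2) > 0"
    using t \<gamma> sin_gt_zero[of "t + \<gamma> - pi"] cos_gt_zero_pi[of "t - pi"] half
    by (auto intro!: sin_gt_zero simp: sin_diff cos_diff)
  have "- sin (t + \<gamma>) + C * (5/2 * ((- cos ((t + \<gamma>) / 2)) * sin t)
      + 2 * (sin ((t + \<gamma>) / 2) * (- cos t))) + 2 * C\<^sup>2 * (sin t * (- cos t)) > 0"
    using * C by (intro add_pos_pos mult_pos_pos) auto
  then have "sin (t + \<gamma>) + C * (5/2 * (cos ((t + \<gamma>) / 2) * sin t) + 2 * (sin ((t + \<gamma>) / 2) * cos t))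
     + 2 * C\<^sup>2 * (sin t * cos t) < 0"
    by (simp add: algebra_simps)
  then show "\<exists>D. (half_force_deriv C \<gamma> has_real_derivative D) (at t) \<and> D < 0"
    using half_force_deriv_has_derivative by blast
qed (auto intro!: continuous_intros simp: half_force_deriv_def)

lemma half_force_deriv_zero_neg:
  assumes C: "C > 0" and \<gamma>: "\<gamma> \<in> {0..<pi/2}"
  shows "half_force_deriv C \<gamma> 0 < 0"
proof -
  have "cos \<gamma> > 0" "cos (\<gamma>/2) > 0"
    using \<gamma> by (auto intro!: cos_gt_zero_pi)
  with C have "cos \<gamma> + C * (2 * cos (\<gamma>/2)) > 0"
    by (intro add_pos_pos mult_pos_pos) auto
  then show ?thesis
    by (simp add: half_force_deriv_def)
qed

text \<open>On this gap between the two monotone ranges no summand is negative, because x + \<gamma>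
  lies in [pi/2, pi]. Strictness comes from C^2 sin^2 x.\<close>

lemma half_force_deriv_middle_pos:
  assumes C: "C > 0" and \<gamma>: "\<gamma> \<in> {0..<pi/2}" and x: "pi/2 \<le> x" "x \<le> pi - \<gamma>"
  shows "half_force_deriv C \<gamma> x > 0"
\<comment> \<open>At pi the square vanishes, but then \<gamma> = 0 and - cos (x + \<gamma>) = 1
  gives strictness.\<close>
proof (cases "x = pi")
  case True
  with x \<gamma> have "\<gamma> = 0" by auto
  with True show ?thesis by (simp add: half_force_deriv_def)
next
  case False
  have "- cos (x + \<gamma>) \<ge> 0" "sin x > 0" "- cos x \<ge> 0" "sin ((x + \<gamma>) / 2) \<ge> 0"
      "cos ((x + \<gamma>) / 2) \<ge> 0"
    using x \<gamma> False cos_ge_zero[of "x + \<gamma> - pi"] cos_ge_zero[of "x - pi"]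
    by (auto intro!: sin_gt_zero sin_ge_zero cos_ge_zero simp: cos_diff)
  then have "- cos (x + \<gamma>) + C * (sin ((x + \<gamma>) / 2) * sin x + 2 * cos ((x + \<gamma>) / 2) * (- cos x))
     + C\<^sup>2 * (sin x)\<^sup>2 > 0"
    using C by (intro add_nonneg_pos add_nonneg_nonneg mult_nonneg_nonneg mult_pos_pos) auto
  then show ?thesis
    by (simp add: half_force_deriv_def algebra_simps)
qed

text \<open>The value b = pi encodes that there is no final decreasing branch, so both cases of the
  theorem share one pattern.\<close>

lemma half_force_deriv_sign_pattern:
  assumes C: "C > 0" and \<gamma>: "\<gamma> \<in> {0..<pi/2}"
  obtains a b where "0 < a" "a < b" "b \<le> pi" "half_force_deriv C \<gamma> pi < 0 \<longleftrightarrow> b < pi"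
    "b < pi \<Longrightarrow> half_force_deriv C \<gamma> b = 0"
    "\<And>x. 0 \<le> x \<Longrightarrow> x < a \<Longrightarrow> half_force_deriv C \<gamma> x < 0"
    "\<And>x. a < x \<Longrightarrow> x < b \<Longrightarrow> half_force_deriv C \<gamma> x > 0"
    "\<And>x. b < x \<Longrightarrow> x \<le> pi \<Longrightarrow> half_force_deriv C \<gamma> x < 0"
proof -
  let ?G = "half_force_deriv C \<gamma>"
  have cont: "continuous_on S ?G" for S
    by (auto intro!: continuous_intros simp: half_force_deriv_def)
  have mid: "?G (pi/2) > 0" "?G (pi - \<gamma>) > 0"
    using half_force_deriv_middle_pos[OF C \<gamma>] \<gamma> by auto
  obtain a where a: "0 \<le> a" "a \<le> pi/2" "?G a = 0"
    using IVT'[of ?G 0 0 "pi/2", OF _ _ _ cont] half_force_deriv_zero_neg[OF C \<gamma>] mid by auto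
  have "a \<noteq> 0" "a \<noteq> pi/2"
    using a half_force_deriv_zero_neg[OF C \<gamma>] mid by force+
  with a have a': "0 < a" "a < pi/2"
    by simp_all
  \<comment> \<open>The weak bound \<open>0 \<le> ?G b\<close> holds in both cases. With strict
    decrease up to b it makes \<open>?G\<close> positive just before b.\<close>
  obtain b where b: "pi - \<gamma> \<le> b" "b \<le> pi" "?G pi < 0 \<longleftrightarrow> b < pi" "0 \<le> ?G b"
    "b < pi \<Longrightarrow> ?G b = 0"
  proof (cases "?G pi < 0")
    case True
    obtain b where "pi - \<gamma> \<le> b" "b \<le> pi" "?G b = 0"
      using IVT2'[of ?G pi 0 "pi - \<gamma>", OF _ _ _ cont] True mid \<gamma> by auto
    then show ?thesis
      using that[of b] True by (auto simp: less_le)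
  next
    case False
    then show ?thesis
      using that[of pi] \<gamma> by auto
  qed
  show thesis
  proof (rule that[of a b])
    show "a < b" using a' b \<gamma> by auto
    show "?G x < 0" if "0 \<le> x" "x < a" for x
      using half_force_deriv_strict_mono[OF C \<gamma>, of x a] that a by auto
    show "?G x > 0" if "a < x" "x < b" for x
    proof -
      consider "x \<le> pi/2" | "pi/2 \<le> x" "x \<le> pi - \<gamma>" | "pi - \<gamma> \<le> x" by linarith
      then show ?thesis
        using half_force_deriv_strict_mono[OF C \<gamma>, of a x] that a b
          half_force_deriv_middle_pos[OF C \<gamma>, of x]
          half_force_deriv_strict_antimono[OF C \<gamma>, of x b]
        by cases auto
    qed
    show "?G x < 0" if "b < x" "x \<le> pi" for x
      using half_force_deriv_strict_antimono[OF C \<gamma>, of b x] that b by auto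
  qed (use a' b in auto)
qed

section \<open>Criteria for local minima\<close>

text \<open>The condition on r is void at x = q, where only the fall from the left matters. This
  serves an equilibrium at pi.\<close>

lemma strict_local_min_on_if_deriv_changes_sign:
  fixes f f' :: "real \<Rightarrow> real"
  assumes f: "\<And>y. (f has_real_derivative f' y) (at y)"
    and x: "x \<in> {p..q}" and "l < x" and r: "x < q \<Longrightarrow> x < r"
    and neg: "\<And>y. l < y \<Longrightarrow> y < x \<Longrightarrow> f' y < 0"
    and pos: "\<And>y. x < y \<Longrightarrow> y < r \<Longrightarrow> f' y > 0"
  shows "strict_local_min_on {p..q} f x"
proof -
  have cont: "continuous_on S f" for S
    using f by (meson DERIV_isCont continuous_at_imp_continuous_on)
  define d where "d = (if x < q then min (x - l) (r - x) else x - l)"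
  have "d > 0" using \<open>l < x\<close> r by (auto simp: d_def)
  moreover have "f x < f y" if y: "y \<in> {p..q}" "y \<noteq> x" "dist y x < d" for y
  proof (cases "y < x")
    case True
    with y have "l < y" by (auto simp: d_def dist_real_def split: if_splits)
    show ?thesis
      by (rule DERIV_neg_imp_decreasing_open[OF True _ cont])
        (use f neg \<open>l < y\<close> in \<open>meson less_trans\<close>)
  next
    case False
    with y have "x < y" "x < q" by auto
    with y have "y < r" by (auto simp: d_def dist_real_def split: if_splits)
    show ?thesis
      by (rule DERIV_pos_imp_increasing_open[OF \<open>x < y\<close> _ cont])
        (use f pos \<open>y < r\<close> in \<open>meson less_trans\<close>)
  qed
  ultimately show ?thesis
    using x unfolding strict_local_min_on_def eventually_at by blast
qed

text \<open>Smaller values need only accumulate at x, so an interval on one side of x will do as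
  T.\<close>

lemma not_local_min_on_if_smaller_values:
  assumes "x islimpt T" "T \<subseteq> S" "\<And>y. y \<in> T \<Longrightarrow> f y < f x"
  shows "\<not> local_min_on S f x"
proof
  assume "local_min_on S f x"
  then obtain U where U: "open U" "x \<in> U" "\<And>y. y \<in> U \<Longrightarrow> y \<noteq> x \<Longrightarrow> y \<in> S \<Longrightarrow> f x \<le> f y"
    by (auto simp: local_min_on_def eventually_at_topological)
  with assms(1) obtain y where "y \<in> T" "y \<in> U" "y \<noteq> x"
    unfolding islimpt_def by blast
  with U assms show False by (meson leD subsetD)
qed

section \<open>Counting the equilibria and their stability\<close>

theorem mainTheorem7:
  fixes A C \<gamma> :: real
  assumes "A > 0" and "C > 0" and "\<gamma> \<in> {0..<pi/2}"
  shows "(deriv (total_force A C \<gamma>) pi \<ge> 0 \<longrightarrow>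
            finite {\<phi>. equilibrium A C \<gamma> \<phi>} \<and> card {\<phi>. equilibrium A C \<gamma> \<phi>} \<le> 1 \<and>
            (\<forall>\<phi>. equilibrium A C \<gamma> \<phi> \<longrightarrow> stable_equilibrium A C \<gamma> \<phi>)) \<and>
         (deriv (total_force A C \<gamma>) pi < 0 \<longrightarrow>
            finite {\<phi>. equilibrium A C \<gamma> \<phi>} \<and> card {\<phi>. equilibrium A C \<gamma> \<phi>} \<le> 2 \<and>
            (\<forall>\<phi>\<^sub>1 \<phi>\<^sub>2. equilibrium A C \<gamma> \<phi>\<^sub>1 \<and> equilibrium A C \<gamma> \<phi>\<^sub>2 \<and> \<phi>\<^sub>1 < \<phi>\<^sub>2 \<longrightarrow>
               stable_equilibrium A C \<gamma> \<phi>\<^sub>1 \<and> unstable_equilibrium A C \<gamma> \<phi>\<^sub>2) \<and>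
            (\<forall>\<phi>. {\<psi>. equilibrium A C \<gamma> \<psi>} = {\<phi>} \<longrightarrow>
               (deriv (total_force A C \<gamma>) \<phi> > 0 \<longrightarrow> stable_equilibrium A C \<gamma> \<phi>) \<and>
               (deriv (total_force A C \<gamma>) \<phi> = 0 \<longrightarrow> unstable_equilibrium A C \<gamma> \<phi>)))"
proof -
  let ?F = "total_force A C \<gamma>" and ?E = "total_energy A C \<gamma>" and ?G = "half_force_deriv C \<gamma>"
  let ?k = "\<lambda>x. sin x + sin ((x + \<gamma>) / 2) / C"
  note C = assms(2) and \<gamma> = assms(3)
  obtain a b where a: "0 < a" "a < b" and b: "b \<le> pi" "?G pi < 0 \<longleftrightarrow> b < pi"
    and Gb: "b < pi \<Longrightarrow> ?G b = 0"
    and G: "\<And>x. 0 \<le> x \<Longrightarrow> x < a \<Longrightarrow> ?G x < 0" "\<And>x. a < x \<Longrightarrow> x < b \<Longrightarrow> ?G x > 0"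
      "\<And>x. b < x \<Longrightarrow> x \<le> pi \<Longrightarrow> ?G x < 0"
    using half_force_deriv_sign_pattern[OF C \<gamma>] by blast
  have contF: "continuous_on S ?F" for S
    by (auto intro!: continuous_intros simp: total_force_def)
  have contE: "continuous_on S ?E" for S
    using total_energy_has_derivative[OF C]
    by (meson DERIV_isCont continuous_at_imp_continuous_on)
  have dec1: "?F y < ?F x" if "0 \<le> x" "x < y" "y \<le> a" for x y
  proof (rule DERIV_neg_imp_decreasing_open[OF that(2) _ contF])
    fix t assume "x < t" "t < y"
    then have "2 * ?G t < 0"
      using G(1)[of t] that a by auto
    then show "\<exists>D. (?F has_real_derivative D) (at t) \<and> D < 0"
      using total_force_has_derivative by blast
  qed
  have inc: "?F x < ?F y" if "a \<le> x" "x < y" "y \<le> b" for x y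
  proof (rule DERIV_pos_imp_increasing_open[OF that(2) _ contF])
    fix t assume "x < t" "t < y"
    then have "2 * ?G t > 0"
      using G(2)[of t] that a by auto
    then show "\<exists>D. (?F has_real_derivative D) (at t) \<and> 0 < D"
      using total_force_has_derivative by blast
  qed
  have dec2: "?F y < ?F x" if "b \<le> x" "x < y" "y \<le> pi" for x y
  proof (rule DERIV_neg_imp_decreasing_open[OF that(2) _ contF])
    fix t assume "x < t" "t < y"
    then have "2 * ?G t < 0"
      using G(3)[of t] that a by auto
    then show "\<exists>D. (?F has_real_derivative D) (at t) \<and> D < 0"
      using total_force_has_derivative by blast
  qed
  have "sin \<gamma> \<ge> 0" using \<gamma> by (intro sin_ge_zero) auto
  then have "A * C\<^sup>2 + 2 * sin \<gamma> > 0"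
    using assms(1) C by (intro add_pos_nonneg) auto
  then have F0: "?F 0 < 0"
    by (simp add: total_force_def)
  \<comment> \<open>At 0 the factor vanishes when \<gamma> = 0. Excluding 0 is harmless, since all
    equilibria lie beyond a > 0.\<close>
  have k: "?k x > 0" if "0 < x" "x \<le> pi" for x
  proof -
    have "sin ((x + \<gamma>) / 2) > 0" "sin x \<ge> 0"
      using that \<gamma> by (auto intro!: sin_gt_zero sin_ge_zero)
    with C show ?thesis by (simp add: add_nonneg_pos)
  qed
  have Fa: "?F x < 0" if "0 \<le> x" "x \<le> a" for x
    using dec1[of 0 x] F0 that by (cases "x = 0") auto
  have eq: "a < x \<and> x \<le> pi \<and> ?F x = 0" if "equilibrium A C \<gamma> x" for x
    using that Fa[of x] by (force simp: equilibrium_def)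
  \<comment> \<open>Both uniqueness ranges contain b, so an equilibrium at b excludes any other; two
    distinct ones lie strictly on either side of b.\<close>
  have uniq1: "x = y" if "equilibrium A C \<gamma> x" "equilibrium A C \<gamma> y" "x \<le> b" "y \<le> b" for x y
    using inc[of x y] inc[of y x] eq[OF that(1)] eq[OF that(2)] that(3,4)
    by (cases x y rule: linorder_cases) auto
  have uniq2: "x = y" if "equilibrium A C \<gamma> x" "equilibrium A C \<gamma> y" "b \<le> x" "b \<le> y" for x y
    using dec2[of x y] dec2[of y x] eq[OF that(1)] eq[OF that(2)] that(3,4)
    by (cases x y rule: linorder_cases) auto
  have stable: "stable_equilibrium A C \<gamma> x"
    if x: "equilibrium A C \<gamma> x" and xb: "x < b \<or> x = b \<and> b = pi" for x
  proof -
    have "strict_local_min_on {0..pi} ?E x"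
    proof (rule strict_local_min_on_if_deriv_changes_sign[where l = a and r = b,
          OF total_energy_has_derivative[OF C]])
      show "?k y * ?F y < 0" if "a < y" "y < x" for y
        using inc[of y x] k[of y] eq[OF x] that xb a b by (intro mult_pos_neg) auto
      show "?k y * ?F y > 0" if "x < y" "y < b" for y
        using inc[of x y] k[of y] eq[OF x] that xb a b by (intro mult_pos_pos) auto
    qed (use eq[OF x] xb a in auto)
    with x show ?thesis by (simp add: stable_equilibrium_def)
  qed
  have unstable: "unstable_equilibrium A C \<gamma> x"
    if x: "equilibrium A C \<gamma> x" and xb: "b < x" for x
  proof -
    \<comment> \<open>Between b and x the force is positive, so the energy rises towards x. The left
      side is used because x may be pi.\<close>
    have "?E y < ?E x" if y: "y \<in> {b<..<x}" for y
    proof (rule DERIV_pos_imp_increasing_open[OF _ _ contE])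
      fix t assume t: "y < t" "t < x"
      have "?k t * ?F t > 0"
        using dec2[of t x] k[of t] eq[OF x] t y a by (intro mult_pos_pos) auto
      then show "\<exists>D. (?E has_real_derivative D) (at t) \<and> 0 < D"
        using total_energy_has_derivative[OF C] by blast
    qed (use y in auto)
    moreover have "{b<..<x} \<subseteq> {0..pi}" using eq[OF x] a by auto
    moreover have "x islimpt {b<..<x}"
      using xb by (rule islimpt_greaterThanLessThan2)
    ultimately have "\<not> local_min_on {0..pi} ?E x"
      by (intro not_local_min_on_if_smaller_values)
    with x show ?thesis by (simp add: unstable_equilibrium_def)
  qed
  have unstable_b: "unstable_equilibrium A C \<gamma> b" if x: "equilibrium A C \<gamma> b" and "b < pi"
  proof -
    \<comment> \<open>The force peaks with value 0 at b, so it is negative on both sides nearby and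
      the energy falls through b. Smaller values are found on the right.\<close>
    have "?E y < ?E b" if y: "y \<in> {b<..<pi}" for y
    proof (rule DERIV_neg_imp_decreasing_open[OF _ _ contE])
      fix t assume t: "b < t" "t < y"
      have "?k t * ?F t < 0"
        using dec2[of b t] k[of t] eq[OF x] t y a by (intro mult_pos_neg) auto
      then show "\<exists>D. (?E has_real_derivative D) (at t) \<and> D < 0"
        using total_energy_has_derivative[OF C] by blast
    qed (use y in auto)
    moreover have "{b<..<pi} \<subseteq> {0..pi}" using a by auto
    moreover have "b islimpt {b<..<pi}"
      using \<open>b < pi\<close> by (rule islimpt_greaterThanLessThan1)
    ultimately have "\<not> local_min_on {0..pi} ?E b"
      by (intro not_local_min_on_if_smaller_values)
    with x show ?thesis by (simp add: unstable_equilibrium_def)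
  qed
  let ?S = "{x. equilibrium A C \<gamma> x}"
  \<comment> \<open>If there is no equilibrium on this side, u is arbitrary; likewise v
    below.\<close>
  obtain u where u: "?S \<inter> {..b} \<subseteq> {u}"
    using uniq1 by blast
  obtain v where v: "?S \<inter> {b..} \<subseteq> {v}"
    using uniq2 by blast
  have S2: "?S \<subseteq> {u, v}"
    using u v by force
  have fin: "finite ?S" using S2 by (rule finite_subset) simp
  have card2: "card ?S \<le> 2"
    using card_mono[OF _ S2] by (simp add: card_insert_if split: if_splits)
  show ?thesis
  proof (intro conjI impI allI)
    assume "deriv ?F pi \<ge> 0"
    then have "b = pi" using b by (simp add: deriv_total_force)
    then have "?S \<subseteq> {u}" using u eq by fastforce
    then show "card ?S \<le> 1" using card_mono[of "{u}" ?S] by simp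
    show "stable_equilibrium A C \<gamma> x" if "equilibrium A C \<gamma> x" for x
      using stable[OF that] eq[OF that] \<open>b = pi\<close> by (simp add: le_less)
  next
    fix x y
    assume xy: "equilibrium A C \<gamma> x \<and> equilibrium A C \<gamma> y \<and> x < y"
    then have "x < b" "b < y"
      using uniq1[of x y] uniq2[of x y] by force+
    with xy show "stable_equilibrium A C \<gamma> x" "unstable_equilibrium A C \<gamma> y"
      using stable unstable by auto
  next
    fix x
    assume "deriv ?F pi < 0" and "?S = {x}"
    then have "b < pi" and x: "equilibrium A C \<gamma> x"
      using b by (auto simp: deriv_total_force)
    {
      assume "deriv ?F x > 0"
      then have "\<not> b < x" "x \<noteq> b"
        using G(3)[of x] eq[OF x] Gb \<open>b < pi\<close> by (auto simp: deriv_total_force)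
      then show "stable_equilibrium A C \<gamma> x" using stable[OF x] by auto
    next
      assume "deriv ?F x = 0"
      \<comment> \<open>Beyond a, the derivative of the force vanishes only at b.\<close>
      then have "x = b"
        using G(2,3)[of x] eq[OF x] by (cases x b rule: linorder_cases) (auto simp: deriv_total_force)
      with x \<open>b < pi\<close> show "unstable_equilibrium A C \<gamma> x" using unstable_b by simp
    }
  qed (use fin card2 in auto)
qed

end
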